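(* Let $\mathfrak B$ be a Boolean algebra freely generated by $\mathcal G=\{A_1,A_2,A_3,A_4\}$, and let $\mathfrak B_{ij}$, $\mathfrak B_{ijk}$ be the subalgebras generated respectively by $\{A_i,A_j\}$ and $\{A_i,A_j,A_k\}$. Consider $f:\mathfrak B_{13}\cup\mathfrak B_{23}\cup\mathfrak B_{14}\cup\mathfrak B_{24}\to[0,1]$ such that $f|_{\mathfrak B_{13}}$, $f|_{\mathfrak B_{23}}$, $f|_{\mathfrak B_{14}}$ and $f|_{\mathfrak B_{24}}$ are normalized measures on these subalgebras. Then $f$ is extensible to a normalized measure on $\mathfrak B$ if and only if there exist normalized measures $f^{123}$ on $\mathfrak B_{123}$ and $f^{124}$ on $\mathfrak B_{124}$, extending respectively $f|_{\mathfrak B_{13}\cup\mathfrak B_{23}}$ and $f|_{\mathfrak B_{14}\cup\mathfrak B_{24}}$, such that $f^{123}|_{\mathfrak B_{12}}= f^{124}|_{\mathfrak B_{12}}$.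
   Context: A normalized measure on a Boolean algebra is a non-negative real function, additive on disjoint elements, taking the value $1$ on the unit. *)

theory Defs
  imports Complex_Main "HOL-Library.FuncSet" "HOL-Library.Countable_Set"
begin

definition boolean_subalgebra :: "'a::boolean_algebra set \<Rightarrow> bool" where
  "boolean_subalgebra S \<longleftrightarrow>
     bot \<in> S \<and> top \<in> S \<and>
     (\<forall>x\<in>S. - x \<in> S) \<and>
     (\<forall>x\<in>S. \<forall>y\<in>S. inf x y \<in> S) \<and>
     (\<forall>x\<in>S. \<forall>y\<in>S. sup x y \<in> S)"

abbreviation generated_subalgebra :: "'a::boolean_algebra set \<Rightarrow> 'a set" where
  "generated_subalgebra X \<equiv> boolean_subalgebra hull X"

definition normalized_measure_on :: "'a::boolean_algebra set \<Rightarrow> ('a \<Rightarrow> real) \<Rightarrow> bool" where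
  "normalized_measure_on S m \<longleftrightarrow>
     (\<forall>x\<in>S. 0 \<le> m x) \<and>
     (\<forall>x\<in>S. \<forall>y\<in>S. inf x y = bot \<longrightarrow> m (sup x y) = m x + m y) \<and>
     m top = 1"

text \<open>Boolean algebras with an explicit carrier (Huntington's axioms). The degenerate algebra
  with zero = one is allowed, as in the type class.\<close>

locale boolean_algebra_on =
  fixes C :: "'b set"
    and meet join :: "'b \<Rightarrow> 'b \<Rightarrow> 'b"
    and compl :: "'b \<Rightarrow> 'b"
    and zero one :: 'b
  assumes meet_closed: "x \<in> C \<Longrightarrow> y \<in> C \<Longrightarrow> meet x y \<in> C"
    and join_closed: "x \<in> C \<Longrightarrow> y \<in> C \<Longrightarrow> join x y \<in> C"
    and compl_closed: "x \<in> C \<Longrightarrow> compl x \<in> C"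
    and zero_closed: "zero \<in> C"
    and one_closed: "one \<in> C"
    and meet_commute: "x \<in> C \<Longrightarrow> y \<in> C \<Longrightarrow> meet x y = meet y x"
    and join_commute: "x \<in> C \<Longrightarrow> y \<in> C \<Longrightarrow> join x y = join y x"
    and meet_join_distrib: "x \<in> C \<Longrightarrow> y \<in> C \<Longrightarrow> z \<in> C \<Longrightarrow>
          meet x (join y z) = join (meet x y) (meet x z)"
    and join_meet_distrib: "x \<in> C \<Longrightarrow> y \<in> C \<Longrightarrow> z \<in> C \<Longrightarrow>
          join x (meet y z) = meet (join x y) (join x z)"
    and meet_one: "x \<in> C \<Longrightarrow> meet x one = x"
    and join_zero: "x \<in> C \<Longrightarrow> join x zero = x"
    and meet_compl: "x \<in> C \<Longrightarrow> meet x (compl x) = zero"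
    and join_compl: "x \<in> C \<Longrightarrow> join x (compl x) = one"

definition boolean_hom_to ::
  "'b set \<Rightarrow> ('b \<Rightarrow> 'b \<Rightarrow> 'b) \<Rightarrow> ('b \<Rightarrow> 'b \<Rightarrow> 'b) \<Rightarrow> ('b \<Rightarrow> 'b) \<Rightarrow> 'b \<Rightarrow> 'b
     \<Rightarrow> ('a::boolean_algebra \<Rightarrow> 'b) \<Rightarrow> bool" where
  "boolean_hom_to C meet join compl zero one \<phi> \<longleftrightarrow>
     range \<phi> \<subseteq> C \<and>
     (\<forall>x y. \<phi> (inf x y) = meet (\<phi> x) (\<phi> y)) \<and>
     (\<forall>x y. \<phi> (sup x y) = join (\<phi> x) (\<phi> y)) \<and>
     (\<forall>x. \<phi> (- x) = compl (\<phi> x)) \<and>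
     \<phi> bot = zero \<and> \<phi> top = one"

text \<open>Freeness is the universal mapping property: every map from the generators into a Boolean
  algebra extends to a homomorphism. A formula cannot quantify over types, so the target algebras
  range over those carried by sets of naturals, i.e. over all countable Boolean algebras up to
  isomorphism. For countable \<open>G\<close> this loses nothing, since the image of \<open>G\<close> generates a countable
  subalgebra of the target: see \<open>freely_generated_by_extend\<close> below. For uncountable \<open>G\<close>
  the definition is not meant to be used.\<close>

definition freely_generated_by :: "'a::boolean_algebra set \<Rightarrow> bool" where
  "freely_generated_by G \<longleftrightarrow>
     generated_subalgebra G = UNIV \<and>
     (\<forall>(C :: nat set) meet join compl zero one.
        boolean_algebra_on C meet join compl zero one \<longrightarrow>
        (\<forall>h \<in> G \<rightarrow> C. \<exists>\<phi>. boolean_hom_to C meet join compl zero one \<phi> \<and> (\<forall>g\<in>G. \<phi> g = h g)))"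

lemma boolean_subalgebra_hull: "boolean_subalgebra (boolean_subalgebra hull X)"
  by (rule hull_in) (auto simp: boolean_subalgebra_def)

lemma countable_generated_subalgebra:
  assumes "countable X"
  shows "countable (generated_subalgebra X)"
proof -
  define step where "step = (\<lambda>Y :: 'a set. Y \<union> uminus ` Y \<union> (\<lambda>(x, y). inf x y) ` (Y \<times> Y)
                                     \<union> (\<lambda>(x, y). sup x y) ` (Y \<times> Y))"
  define Y where "Y = (\<lambda>n. (step ^^ n) (X \<union> {bot, top}))"
  have YS: "Y (Suc n) = step (Y n)" for n by (simp add: Y_def)
  have Y0: "X \<subseteq> Y 0" "bot \<in> Y 0" "top \<in> Y 0" by (auto simp: Y_def)
  have sup_step: "Z \<subseteq> step Z" for Z by (auto simp: step_def)
  have cnt: "countable (Y n)" for n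
  proof (induction n)
    case 0
    show ?case using assms by (simp add: Y_def)
  next
    case (Suc n)
    then show ?case by (simp add: YS step_def)
  qed
  have mono: "Y m \<subseteq> Y n" if "m \<le> n" for m n
    by (rule lift_Suc_mono_le[OF _ that]) (simp add: YS sup_step)
  have pair: "\<exists>n. x \<in> Y n \<and> y \<in> Y n" if "x \<in> Y i" "y \<in> Y j" for x y i j
    using mono[OF max.cobounded1, of i j] mono[OF max.cobounded2, of j i] that by blast
  have "boolean_subalgebra (\<Union>n. Y n)"
    unfolding boolean_subalgebra_def
  proof (intro conjI ballI)
    show "bot \<in> (\<Union>n. Y n)" "top \<in> (\<Union>n. Y n)" using Y0 by blast+
  next
    fix x assume "x \<in> (\<Union>n. Y n)"
    then obtain n where "x \<in> Y n" by blast
    then have "- x \<in> Y (Suc n)" by (auto simp: YS step_def)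
    then show "- x \<in> (\<Union>n. Y n)" by blast
  next
    fix x y assume "x \<in> (\<Union>n. Y n)" "y \<in> (\<Union>n. Y n)"
    then obtain n where "x \<in> Y n" "y \<in> Y n" using pair by blast
    then have "inf x y \<in> Y (Suc n)" "sup x y \<in> Y (Suc n)" by (force simp: YS step_def)+
    then show "inf x y \<in> (\<Union>n. Y n)" "sup x y \<in> (\<Union>n. Y n)" by blast+
  qed
  moreover have "X \<subseteq> (\<Union>n. Y n)" using Y0 by blast
  ultimately have "generated_subalgebra X \<subseteq> (\<Union>n. Y n)" by (rule hull_minimal[rotated])
  moreover have "countable (\<Union>n. Y n)" using cnt by (intro countable_UN) auto
  ultimately show ?thesis by (rule countable_subset)
qed

lemma freely_generated_by_extend:
  fixes G :: "'a::boolean_algebra set" and h :: "'a \<Rightarrow> 'b::boolean_algebra"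
  assumes "freely_generated_by G" and "countable G"
  shows "\<exists>\<phi>. boolean_hom_to UNIV inf sup uminus bot top \<phi> \<and> (\<forall>g\<in>G. \<phi> g = h g)"
proof -
  define D where "D = generated_subalgebra (h ` G)"
  have sub: "boolean_subalgebra D" unfolding D_def by (rule boolean_subalgebra_hull)
  have D: "bot \<in> D" "top \<in> D" "\<And>x. x \<in> D \<Longrightarrow> - x \<in> D"
      "\<And>x y. x \<in> D \<Longrightarrow> y \<in> D \<Longrightarrow> inf x y \<in> D" "\<And>x y. x \<in> D \<Longrightarrow> y \<in> D \<Longrightarrow> sup x y \<in> D"
    using sub by (auto simp: boolean_subalgebra_def)
  have "countable D" unfolding D_def
    using assms(2) by (intro countable_generated_subalgebra) auto
  then obtain e :: "'b \<Rightarrow> nat" where e: "inj_on e D" by (auto simp: countable_def)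
  define d where "d = inv_into D e"
  have de [simp]: "d (e x) = x" if "x \<in> D" for x
    using e that by (simp add: d_def)
  define C where "C = e ` D"
  have dD: "d c \<in> D" if "c \<in> C" for c using that by (auto simp: C_def)
  have alg: "boolean_algebra_on C (\<lambda>x y. e (inf (d x) (d y))) (\<lambda>x y. e (sup (d x) (d y)))
           (\<lambda>x. e (- d x)) (e bot) (e top)"
  proof unfold_locales
    fix x y z assume "x \<in> C" "y \<in> C" "z \<in> C"
    then have xyz: "d x \<in> D" "d y \<in> D" "d z \<in> D" by (auto intro: dD)
    show "e (inf (d x) (d (e (sup (d y) (d z)))))
        = e (sup (d (e (inf (d x) (d y)))) (d (e (inf (d x) (d z)))))"
      using xyz by (simp add: D inf_sup_distrib1)
    show "e (sup (d x) (d (e (inf (d y) (d z)))))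
        = e (inf (d (e (sup (d x) (d y)))) (d (e (sup (d x) (d z)))))"
      using xyz by (simp add: D sup_inf_distrib1)
  qed (auto simp: C_def D inf.commute sup.commute)
  have hC: "e \<circ> h \<in> G \<rightarrow> C"
    using hull_subset[of "h ` G" boolean_subalgebra] by (auto simp: C_def D_def)
  obtain \<psi> where \<psi>: "boolean_hom_to C (\<lambda>x y. e (inf (d x) (d y))) (\<lambda>x y. e (sup (d x) (d y)))
           (\<lambda>x. e (- d x)) (e bot) (e top) \<psi>" and \<psi>G: "\<forall>g\<in>G. \<psi> g = (e \<circ> h) g"
    using assms(1) alg hC unfolding freely_generated_by_def by blast
  have "\<psi> x \<in> C" for x using \<psi> by (auto simp: boolean_hom_to_def)
  then have "boolean_hom_to UNIV inf sup uminus bot top (d \<circ> \<psi>)"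
    using \<psi> by (simp add: boolean_hom_to_def D dD)
  moreover have "(d \<circ> \<psi>) g = h g" if "g \<in> G" for g
  proof -
    have "h g \<in> D" using that hull_subset[of "h ` G" boolean_subalgebra] by (auto simp: D_def)
    then show ?thesis using \<psi>G that by simp
  qed
  ultimately show ?thesis by blast
qed

end

(* Only the direction from right to left needs an argument. Under an extension of f the generators
   3 and 4 may be taken conditionally independent given the algebra of 1 and 2: the atom with signs
   (a, b, c, d) receives mass f123(abc) f124(abd) / f123(ab). Agreement of f123 and f124 on the
   atoms ab makes both marginals of this weight correct. Freeness supplies, for each choice of
   signs, a two-valued homomorphism, and the extension is the weighted sum of these. *)
theory Submission
  imports Defs
begin

text \<open>Additivity is split off from normalized measures because it alone determines values from
  atoms. The glued function can thus be compared with the given measures before its positivity and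
  total mass are known.\<close>

definition additive_on :: "'a::boolean_algebra set \<Rightarrow> ('a \<Rightarrow> real) \<Rightarrow> bool" where
  "additive_on S m \<longleftrightarrow> (\<forall>x\<in>S. \<forall>y\<in>S. inf x y = bot \<longrightarrow> m (sup x y) = m x + m y)"

text \<open>Indexing a literal by its sign turns splitting along a generator into a sum over
  \<open>bool\<close>.\<close>

definition lit :: "bool \<Rightarrow> 'a::boolean_algebra \<Rightarrow> 'a" where
  "lit e a = (if e then a else - a)"

lemma boolean_subalgebra_closed:
  assumes "boolean_subalgebra S"
  shows "bot \<in> S" "top \<in> S" "x \<in> S \<Longrightarrow> - x \<in> S" "x \<in> S \<Longrightarrow> lit e x \<in> S"
    and "x \<in> S \<Longrightarrow> y \<in> S \<Longrightarrow> inf x y \<in> S" "x \<in> S \<Longrightarrow> y \<in> S \<Longrightarrow> sup x y \<in> S"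
  using assms by (auto simp: boolean_subalgebra_def lit_def)

lemma normalized_measure_on_additive: "normalized_measure_on S m \<Longrightarrow> additive_on S m"
  by (simp add: normalized_measure_on_def additive_on_def)

lemma normalized_measure_on_subset:
  "normalized_measure_on S m \<Longrightarrow> T \<subseteq> S \<Longrightarrow> normalized_measure_on T m"
  unfolding normalized_measure_on_def by blast

lemma additive_on_split:
  assumes "additive_on S m" "boolean_subalgebra S" "x \<in> S" "a \<in> S"
  shows "m x = (\<Sum>e\<in>UNIV. m (inf x (lit e a)))"
proof -
  have "sup (inf x a) (inf x (- a)) = x"
    by (simp flip: inf_sup_distrib1)
  moreover have "inf (inf x a) (inf x (- a)) = bot"
    by (simp add: inf.assoc inf.left_commute[of a])
  ultimately have "m x = m (inf x a) + m (inf x (- a))"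
    using assms boolean_subalgebra_closed[OF assms(2)] unfolding additive_on_def by metis
  then show ?thesis by (simp add: UNIV_bool lit_def)
qed

lemma additive_on_bot:
  assumes "additive_on S m" "bot \<in> S"
  shows "m bot = 0"
  using assms unfolding additive_on_def by fastforce

text \<open>The elements that lie above \<open>a\<close> or are disjoint from it are closed under
  all operations, so for a generated subalgebra this dichotomy need only be checked on
  generators.\<close>

lemma boolean_subalgebra_decided_by:
  "boolean_subalgebra {x. inf x a = bot \<or> inf x a = a}"
proof -
  \<comment> \<open>As order relations the two alternatives are exchanged by complement, and closure
    reduces to lattice inequalities.\<close>
  have *: "inf x a = bot \<longleftrightarrow> a \<le> - x" "inf x a = a \<longleftrightarrow> a \<le> x" for x
    by (metis inf_shunt inf.commute, metis le_iff_inf inf.commute)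
  show ?thesis
    unfolding boolean_subalgebra_def *
    by (auto intro: le_infI1 le_infI2 le_supI1 le_supI2)
qed

text \<open>Splitting \<open>x\<close> along the three generators writes its value as a sum over
  eight meets with products of literals. Each meet is either \<open>bot\<close> or the full product,
  so the values on the products settle everything.\<close>

lemma additive_on_eq_if_eq_on_atoms:
  fixes a b c :: "'a::boolean_algebra"
  defines "S \<equiv> generated_subalgebra {a, b, c}"
  assumes add: "additive_on S m" "additive_on S n"
    and eq: "\<And>i j k. m (inf (inf (lit i a) (lit j b)) (lit k c)) = n (inf (inf (lit i a) (lit j b)) (lit k c))"
    and x: "x \<in> S"
  shows "m x = n x"
proof -
  have S: "boolean_subalgebra S"
    unfolding S_def by (rule boolean_subalgebra_hull)
  have abc: "a \<in> S" "b \<in> S" "c \<in> S"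
    using hull_subset[of "{a, b, c}" boolean_subalgebra] by (auto simp: S_def)
  let ?at = "\<lambda>i j k. inf (inf (lit i a) (lit j b)) (lit k c)"
  have split: "p x = (\<Sum>i\<in>UNIV. \<Sum>j\<in>UNIV. \<Sum>k\<in>UNIV. p (inf x (?at i j k)))"
    if p: "additive_on S p" for p
  proof -
    have "p x = (\<Sum>i\<in>UNIV. p (inf x (lit i a)))"
      by (rule additive_on_split[OF p S x abc(1)])
    also have "\<dots> = (\<Sum>i\<in>UNIV. \<Sum>j\<in>UNIV. p (inf (inf x (lit i a)) (lit j b)))"
      by (intro sum.cong refl additive_on_split[OF p S] boolean_subalgebra_closed[OF S] x abc)
    also have "\<dots> = (\<Sum>i\<in>UNIV. \<Sum>j\<in>UNIV. \<Sum>k\<in>UNIV. p (inf (inf (inf x (lit i a)) (lit j b)) (lit k c)))"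
      by (intro sum.cong refl additive_on_split[OF p S] boolean_subalgebra_closed[OF S] x abc)
    finally show ?thesis by (simp only: inf.assoc)
  qed
  have decided: "inf x (?at i j k) = bot \<or> inf x (?at i j k) = ?at i j k" for i j k
  proof -
    have "S \<subseteq> {x. inf x (?at i j k) = bot \<or> inf x (?at i j k) = ?at i j k}"
      unfolding S_def
    proof (rule hull_minimal)
      \<comment> \<open>A generator lies above the product if its sign there is positive, and is
        disjoint from it otherwise.\<close>
      show "{a, b, c} \<subseteq> {x. inf x (?at i j k) = bot \<or> inf x (?at i j k) = ?at i j k}"
        by (cases i; cases j; cases k) (auto simp: lit_def inf.assoc inf.commute inf.left_commute)
    qed (rule boolean_subalgebra_decided_by)
    then show ?thesis using x by blast
  qed
  have "m (inf x (?at i j k)) = n (inf x (?at i j k))" for i j k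
    using decided[of i j k] eq additive_on_bot[OF add(1)] additive_on_bot[OF add(2)]
      boolean_subalgebra_closed(1)[OF S] by metis
  then show ?thesis
    using split[OF add(1)] split[OF add(2)] by simp
qed

text \<open>One of two nonnegative summands is at most their sum. The bound serves to make the
  numerators of the glued weight vanish wherever its denominator does.\<close>

lemma normalized_measure_on_inf_lit_le:
  assumes "normalized_measure_on S m" "boolean_subalgebra S" "x \<in> S" "a \<in> S"
  shows "m (inf x (lit e a)) \<le> m x"
proof -
  have "inf x (lit d a) \<in> S" for d
    using assms boolean_subalgebra_closed[OF assms(2)] by simp
  then have "0 \<le> m (inf x (lit d a))" for d
    using assms(1) unfolding normalized_measure_on_def by blast
  then show ?thesis
    unfolding additive_on_split[OF normalized_measure_on_additive[OF assms(1)] assms(2-4)]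
    by (intro member_le_sum) auto
qed

text \<open>Freeness extends every assignment of truth values to the generators to a homomorphism
  into \<open>bool\<close>; distinctness lets the four values be prescribed independently.\<close>

lemma two_valued_homs:
  fixes A1 A2 A3 A4 :: "'a::boolean_algebra"
  assumes "distinct [A1, A2, A3, A4]" "freely_generated_by {A1, A2, A3, A4}"
  obtains \<phi> :: "bool \<Rightarrow> bool \<Rightarrow> bool \<Rightarrow> bool \<Rightarrow> 'a \<Rightarrow> bool"
  where "\<And>i j k l. boolean_hom_to UNIV inf sup uminus bot top (\<phi> i j k l)"
    and "\<And>i j k l. \<phi> i j k l A1 = i" "\<And>i j k l. \<phi> i j k l A2 = j"
    and "\<And>i j k l. \<phi> i j k l A3 = k" "\<And>i j k l. \<phi> i j k l A4 = l"
proof -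
  have "\<exists>\<phi> :: 'a \<Rightarrow> bool. boolean_hom_to UNIV inf sup uminus bot top \<phi>
      \<and> \<phi> A1 = i \<and> \<phi> A2 = j \<and> \<phi> A3 = k \<and> \<phi> A4 = l" for i j k l
    using freely_generated_by_extend[OF assms(2),
        of "\<lambda>x. if x = A1 then i else if x = A2 then j else if x = A3 then k else l"] assms(1)
    by auto
  then show ?thesis using that by metis
qed

text \<open>Amalgamation of two measures over the subalgebra of \<open>A1\<close> and
  \<open>A2\<close>, stated without \<open>f\<close>. The weights below are indexed by sign patterns
  \<open>i j k l\<close>.\<close>

lemma normalized_measure_glue:
  fixes A1 A2 A3 A4 :: "'a::boolean_algebra"
  assumes free: "distinct [A1, A2, A3, A4]" "freely_generated_by {A1, A2, A3, A4}"
    and g: "normalized_measure_on (generated_subalgebra {A1, A2, A3}) g"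
    and h: "normalized_measure_on (generated_subalgebra {A1, A2, A4}) h"
    and gh: "\<And>x. x \<in> generated_subalgebra {A1, A2} \<Longrightarrow> g x = h x"
  obtains m where "normalized_measure_on UNIV m"
    and "\<And>x. x \<in> generated_subalgebra {A1, A2, A3} \<Longrightarrow> m x = g x"
    and "\<And>x. x \<in> generated_subalgebra {A1, A2, A4} \<Longrightarrow> m x = h x"
proof -
  obtain \<phi> :: "bool \<Rightarrow> bool \<Rightarrow> bool \<Rightarrow> bool \<Rightarrow> 'a \<Rightarrow> bool"
    where hom: "\<And>i j k l. boolean_hom_to UNIV inf sup uminus bot top (\<phi> i j k l)"
      and \<phi>A: "\<And>i j k l. \<phi> i j k l A1 = i" "\<And>i j k l. \<phi> i j k l A2 = j"
        "\<And>i j k l. \<phi> i j k l A3 = k" "\<And>i j k l. \<phi> i j k l A4 = l"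
    using two_valued_homs[OF free] by metis
  have \<phi>: "\<phi> i j k l (inf x y) \<longleftrightarrow> \<phi> i j k l x \<and> \<phi> i j k l y"
      "\<phi> i j k l (sup x y) \<longleftrightarrow> \<phi> i j k l x \<or> \<phi> i j k l y"
      "\<phi> i j k l (- x) \<longleftrightarrow> \<not> \<phi> i j k l x" "\<not> \<phi> i j k l bot" "\<phi> i j k l top"
      "\<phi> i j k l (lit e x) \<longleftrightarrow> \<phi> i j k l x = e" for i j k l e x y
    using hom[of i j k l] by (auto simp: boolean_hom_to_def lit_def)
  let ?S = "generated_subalgebra {A1, A2, A3}" and ?T = "generated_subalgebra {A1, A2, A4}"
  have S: "boolean_subalgebra ?S" and T: "boolean_subalgebra ?T"
    and U: "boolean_subalgebra (generated_subalgebra {A1, A2})"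
    by (rule boolean_subalgebra_hull)+
  have memS: "A1 \<in> ?S" "A2 \<in> ?S" "A3 \<in> ?S"
    using hull_subset[of "{A1, A2, A3}" boolean_subalgebra] by auto
  have memT: "A1 \<in> ?T" "A2 \<in> ?T" "A4 \<in> ?T"
    using hull_subset[of "{A1, A2, A4}" boolean_subalgebra] by auto
  have memU: "A1 \<in> generated_subalgebra {A1, A2}" "A2 \<in> generated_subalgebra {A1, A2}"
    using hull_subset[of "{A1, A2}" boolean_subalgebra] by auto
  \<comment> \<open>These products lie in both larger subalgebras, and there \<open>g\<close> and
    \<open>h\<close> agree; they are the events conditioned on.\<close>
  define q where "q i j = inf (lit i A1) (lit j A2)" for i j
  have qS: "q i j \<in> ?S" and qT: "q i j \<in> ?T" for i j
    using memS memT boolean_subalgebra_closed[OF S] boolean_subalgebra_closed[OF T]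
    by (simp_all add: q_def)
  have q: "g (q i j) = h (q i j)" for i j
    using memU boolean_subalgebra_closed[OF U] by (intro gh) (simp add: q_def)
  define u where "u i j k = g (inf (q i j) (lit k A3))" for i j k
  define v where "v i j l = h (inf (q i j) (lit l A4))" for i j l
  have sum_u: "(\<Sum>k\<in>UNIV. u i j k) = g (q i j)" for i j
    using additive_on_split[OF normalized_measure_on_additive[OF g] S qS memS(3)]
    by (simp add: u_def)
  have sum_v: "(\<Sum>l\<in>UNIV. v i j l) = g (q i j)" for i j
    using additive_on_split[OF normalized_measure_on_additive[OF h] T qT memT(3)]
    by (simp add: v_def q)
  have u0: "0 \<le> u i j k" and v0: "0 \<le> v i j k" and q0: "0 \<le> g (q i j)" for i j k
    using g h unfolding u_def v_def normalized_measure_on_def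
    by (simp_all add: qS qT memS memT boolean_subalgebra_closed[OF S] boolean_subalgebra_closed[OF T])
  have u_le: "u i j k \<le> g (q i j)" and v_le: "v i j k \<le> g (q i j)" for i j k
    using normalized_measure_on_inf_lit_le[OF g S qS memS(3)] normalized_measure_on_inf_lit_le[OF h T qT memT(3)]
    by (simp_all add: u_def v_def q)
  define w where "w i j k l = u i j k * v i j l / g (q i j)" for i j k l
  have w0: "0 \<le> w i j k l" for i j k l
    by (simp add: w_def u0 v0 q0)
  text \<open>If \<open>g (q i j) = 0\<close>, then \<open>w\<close> is \<open>0\<close> by the convention on division, and so are \<open>u\<close> and \<open>v\<close>.\<close>
  have marg_u: "(\<Sum>l\<in>UNIV. w i j k l) = u i j k" for i j k
    using u_le[of i j k] u0[of i j k]
    by (cases "g (q i j) = 0")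
      (simp_all add: w_def sum_v flip: sum_distrib_left sum_divide_distrib)
  have marg_v: "(\<Sum>k\<in>UNIV. w i j k l) = v i j l" for i j l
    using v_le[of i j l] v0[of i j l]
    by (cases "g (q i j) = 0")
      (simp_all add: w_def sum_u flip: sum_distrib_right sum_divide_distrib)
  \<comment> \<open>A mixture of two-valued measures: the weights of all sign patterns whose
    homomorphism sends \<open>x\<close> to \<open>True\<close> are added up.\<close>
  define m where "m x = (\<Sum>i\<in>UNIV. \<Sum>j\<in>UNIV. \<Sum>k\<in>UNIV. \<Sum>l\<in>UNIV. w i j k l * of_bool (\<phi> i j k l x))"
    for x
  \<comment> \<open>No homomorphism makes two disjoint elements both true, so the indicators add.
    The carrier is left open since three different ones are needed later.\<close>
  have add: "additive_on R m" for R
    unfolding additive_on_def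
  proof (intro ballI impI)
    fix x y :: 'a assume "inf x y = bot"
    then have "\<not> (\<phi> i j k l x \<and> \<phi> i j k l y)" for i j k l
      using \<phi>(1,4) by metis
    then have "of_bool (\<phi> i j k l (sup x y)) = of_bool (\<phi> i j k l x) + (of_bool (\<phi> i j k l y) :: real)"
      for i j k l
      by (auto simp: \<phi>)
    then show "m (sup x y) = m x + m y"
      by (simp add: m_def distrib_left sum.distrib)
  qed
  \<comment> \<open>Three literals fix three signs of the pattern. What remains is the sum of
    \<open>w\<close> over the fourth sign, which is a marginal computed above.\<close>
  have m_atom: "m (inf (q i j) (lit k A3)) = u i j k"
      "m (inf (q i j) (lit l A4)) = v i j l" for i j k l
    unfolding marg_u[symmetric] marg_v[symmetric] m_def
    by (cases i; cases j; cases k; cases l; simp add: UNIV_bool \<phi> \<phi>A q_def)+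
  have mg: "m x = g x" if "x \<in> ?S" for x
    using add normalized_measure_on_additive[OF g] _ that
    by (rule additive_on_eq_if_eq_on_atoms) (use m_atom in \<open>simp add: q_def u_def\<close>)
  have mh: "m x = h x" if "x \<in> ?T" for x
    using add normalized_measure_on_additive[OF h] _ that
    by (rule additive_on_eq_if_eq_on_atoms) (use m_atom in \<open>simp add: q_def v_def\<close>)
  \<comment> \<open>The total mass is read off from \<open>g\<close>, as \<open>top\<close> lies in
    its domain.\<close>
  have "m top = 1"
    using mg[of top] boolean_subalgebra_closed(2)[OF S] g by (simp add: normalized_measure_on_def)
  moreover have "0 \<le> m x" for x
    by (simp add: m_def sum_nonneg w0)
  ultimately have "normalized_measure_on UNIV m"
    using add[of UNIV] by (simp add: normalized_measure_on_def additive_on_def)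
  then show ?thesis using that mg mh by blast
qed

theorem mainTheorem4:
  fixes A1 A2 A3 A4 :: "'a::boolean_algebra"
    and f :: "'a \<Rightarrow> real"
  assumes "distinct [A1, A2, A3, A4]"
    and "freely_generated_by {A1, A2, A3, A4}"
    and "f \<in> generated_subalgebra {A1, A3} \<union> generated_subalgebra {A2, A3}
             \<union> generated_subalgebra {A1, A4} \<union> generated_subalgebra {A2, A4} \<rightarrow> {0..1}"
    and "normalized_measure_on (generated_subalgebra {A1, A3}) f"
    and "normalized_measure_on (generated_subalgebra {A2, A3}) f"
    and "normalized_measure_on (generated_subalgebra {A1, A4}) f"
    and "normalized_measure_on (generated_subalgebra {A2, A4}) f"
  shows "(\<exists>m. normalized_measure_on UNIV m \<and>
              (\<forall>x \<in> generated_subalgebra {A1, A3} \<union> generated_subalgebra {A2, A3}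
                      \<union> generated_subalgebra {A1, A4} \<union> generated_subalgebra {A2, A4}.
                 m x = f x))
         \<longleftrightarrow>
         (\<exists>f123 f124.
              normalized_measure_on (generated_subalgebra {A1, A2, A3}) f123 \<and>
              normalized_measure_on (generated_subalgebra {A1, A2, A4}) f124 \<and>
              (\<forall>x \<in> generated_subalgebra {A1, A3} \<union> generated_subalgebra {A2, A3}.
                 f123 x = f x) \<and>
              (\<forall>x \<in> generated_subalgebra {A1, A4} \<union> generated_subalgebra {A2, A4}.
                 f124 x = f x) \<and>
              (\<forall>x \<in> generated_subalgebra {A1, A2}. f123 x = f124 x))"
  (is "?L \<longleftrightarrow> ?R")
proof
  assume ?L
  then obtain m where "normalized_measure_on UNIV m"
    and "\<forall>x \<in> generated_subalgebra {A1, A3} \<union> generated_subalgebra {A2, A3}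
                \<union> generated_subalgebra {A1, A4} \<union> generated_subalgebra {A2, A4}. m x = f x"
    by blast
  \<comment> \<open>The same \<open>m\<close> serves as both \<open>f123\<close> and
    \<open>f124\<close>, so they agree trivially on the common subalgebra.\<close>
  then show ?R
    using normalized_measure_on_subset[of UNIV m] by (intro exI[of _ m]) auto
next
  assume ?R
  then obtain g h where g: "normalized_measure_on (generated_subalgebra {A1, A2, A3}) g"
    and h: "normalized_measure_on (generated_subalgebra {A1, A2, A4}) h"
    and gf: "\<forall>x \<in> generated_subalgebra {A1, A3} \<union> generated_subalgebra {A2, A3}. g x = f x"
    and hf: "\<forall>x \<in> generated_subalgebra {A1, A4} \<union> generated_subalgebra {A2, A4}. h x = f x"
    and gh: "\<And>x. x \<in> generated_subalgebra {A1, A2} \<Longrightarrow> g x = h x"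
    by blast
  obtain m where "normalized_measure_on UNIV m"
    and "\<And>x. x \<in> generated_subalgebra {A1, A2, A3} \<Longrightarrow> m x = g x"
    and "\<And>x. x \<in> generated_subalgebra {A1, A2, A4} \<Longrightarrow> m x = h x"
    using normalized_measure_glue[OF assms(1,2) g h gh] by blast
  \<comment> \<open>Each two-generator algebra on which \<open>f\<close> is given sits inside the
    domain of \<open>g\<close> or of \<open>h\<close>, so \<open>m\<close> agrees with
    \<open>f\<close> there.\<close>
  moreover have "generated_subalgebra {A1, A3} \<subseteq> generated_subalgebra {A1, A2, A3}"
    "generated_subalgebra {A2, A3} \<subseteq> generated_subalgebra {A1, A2, A3}"
    "generated_subalgebra {A1, A4} \<subseteq> generated_subalgebra {A1, A2, A4}"
    "generated_subalgebra {A2, A4} \<subseteq> generated_subalgebra {A1, A2, A4}"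
    by (rule hull_mono; blast)+
  ultimately show ?L
    using gf hf by (intro exI[of _ m]) (auto simp: subset_iff)
qed

end
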